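(* Any (possibly randomized) $\alpha$-approximation algorithm for the maximum weight matching problem has Lipschitz constant $\Omega(\alpha)$; that is, there is an input graph on which its Lipschitz constant is at least $c\alpha$ for an absolute constant $c>0$.
   Context: Maximum weight matching problem: given an undirected graph $G=(V,E)$ (parallel edges allowed) and $w\in\mathbb{R}_{\geq0}^E$, output a matching $M$ maximizing $\sum_{e\in M}w(e)$. A randomized algorithm is an $\alpha$-approximation ($0<\alpha\le 1$) if the expected weight of its output is at least $\alpha$ times the maximum matching weight. For edge sets $F,F'$, $d_w((F,w),(F',w'))=\|\sum_{e\in F}w(e)\mathbf{1}_e-\sum_{e\in F'}w'(e)\mathbf{1}_e\|_1$; $\mathrm{EM}_\mathrm{w}$ of two output distributions is the minimum over couplings of the expected $d_w$; the Lipschitz constant of $\mathcal{A}$ on $G$ is $\sup_{w\neq w'}\mathrm{EM}_\mathrm{w}((\mathcal{A}(G,w),w),(\mathcal{A}(G,w'),w'))/\|w-w'\|_1$. *)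

theory Defs
  imports "HOL-Probability.Probability"
begin

text \<open>Finite undirected loopless multigraphs: edges are identifiers mapped to two-element vertex
  sets, so that parallel edges are distinct identifiers with the same ends. The incidence map is
  extensional, so it carries no data beyond the graph itself.\<close>

record ('v, 'e) multigraph =
  verts :: "'v set"
  edges :: "'e set"
  ends :: "'e \<Rightarrow> 'v set"

definition is_multigraph :: "('v, 'e) multigraph \<Rightarrow> bool" where
  "is_multigraph G \<longleftrightarrow> finite (verts G) \<and> finite (edges G) \<and>
     ends G \<in> edges G \<rightarrow>\<^sub>E {e. e \<subseteq> verts G \<and> card e = 2}"

text \<open>The nonnegative orthant of the space of real vectors indexed by the edges. Extensionality makes equality of
  weight functions the same as equality on the edges.\<close>

definition weights :: "('v, 'e) multigraph \<Rightarrow> ('e \<Rightarrow> real) set" where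
  "weights G = edges G \<rightarrow>\<^sub>E {0..}"

definition matchings :: "('v, 'e) multigraph \<Rightarrow> 'e set set" where
  "matchings G = {M. M \<subseteq> edges G \<and> disjoint_family_on (ends G) M}"

definition max_matching_weight :: "('v, 'e) multigraph \<Rightarrow> ('e \<Rightarrow> real) \<Rightarrow> real" where
  "max_matching_weight G w = Max ((\<lambda>M. \<Sum>e\<in>M. w e) ` matchings G)"

text \<open>A randomized algorithm is identified with its output distribution on each input; no
  computability or complexity restriction is imposed.\<close>

type_synonym ('v, 'e) algorithm = "('v, 'e) multigraph \<Rightarrow> ('e \<Rightarrow> real) \<Rightarrow> 'e set pmf"

definition matching_algorithm :: "('v, 'e) algorithm \<Rightarrow> bool" where
  "matching_algorithm A \<longleftrightarrow>
     (\<forall>G w. is_multigraph G \<longrightarrow> w \<in> weights G \<longrightarrow> set_pmf (A G w) \<subseteq> matchings G)"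

definition approximation_algorithm :: "real \<Rightarrow> ('v, 'e) algorithm \<Rightarrow> bool" where
  "approximation_algorithm \<alpha> A \<longleftrightarrow> matching_algorithm A \<and>
     (\<forall>G w. is_multigraph G \<longrightarrow> w \<in> weights G \<longrightarrow>
        measure_pmf.expectation (A G w) (\<lambda>M. \<Sum>e\<in>M. w e) \<ge> \<alpha> * max_matching_weight G w)"

definition l1_norm :: "('v, 'e) multigraph \<Rightarrow> ('e \<Rightarrow> real) \<Rightarrow> real" where
  "l1_norm G x = (\<Sum>e\<in>edges G. \<bar>x e\<bar>)"

definition weighted_dist ::
  "('v, 'e) multigraph \<Rightarrow> 'e set \<times> ('e \<Rightarrow> real) \<Rightarrow> 'e set \<times> ('e \<Rightarrow> real) \<Rightarrow> real" where
  "weighted_dist G = (\<lambda>(F, w) (F', w'). l1_norm G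
     (\<lambda>f. (\<Sum>e\<in>F. w e * indicator {e} f) - (\<Sum>e\<in>F'. w' e * indicator {e} f)))"

definition couplings :: "'a pmf \<Rightarrow> 'b pmf \<Rightarrow> ('a \<times> 'b) pmf set" where
  "couplings p q = {D. map_pmf fst D = p \<and> map_pmf snd D = q}"

text \<open>Each argument pairs a distribution over edge sets with the fixed weight function
  attached to its samples.\<close>

definition weighted_EM ::
  "('v, 'e) multigraph \<Rightarrow> 'e set pmf \<times> ('e \<Rightarrow> real) \<Rightarrow> 'e set pmf \<times> ('e \<Rightarrow> real) \<Rightarrow> real" where
  "weighted_EM G = (\<lambda>(p, w) (p', w'). INF D\<in>couplings p p'.
     measure_pmf.expectation D (\<lambda>(F, F'). weighted_dist G (F, w) (F', w')))"

text \<open>The supremum may be infinite, hence extended nonnegative reals.\<close>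

definition lipschitz_constant :: "('v, 'e) algorithm \<Rightarrow> ('v, 'e) multigraph \<Rightarrow> ennreal" where
  "lipschitz_constant A G =
     (SUP (w, w') \<in> {(w, w'). w \<in> weights G \<and> w' \<in> weights G \<and> w \<noteq> w'}.
        ennreal (weighted_EM G (A G w, w) (A G w', w') / l1_norm G (\<lambda>e. w e - w' e)))"

end

theory Submission
  imports Defs
begin

text \<open>Compare a weight function \<open>w\<close> with the zero weight function: whatever is output on the latter
  has the zero vector attached to it, so every coupling costs exactly the expected weight of the
  output on \<open>w\<close>, which is at least \<open>\<alpha>\<close> times the maximum matching weight. On a single edge of
  weight one that maximum equals the distance of the two weight functions.\<close>

lemma weighted_dist_zero:
  assumes "finite (edges G)" "F \<subseteq> edges G" "F' \<subseteq> edges G" "w \<in> weights G"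
  shows "weighted_dist G (F, w) (F', \<lambda>e\<in>edges G. 0) = (\<Sum>e\<in>F. w e)"
proof -
  have finF: "finite F"
    using assms finite_subset by blast
  have w: "w e \<ge> 0" if "e \<in> edges G" for e
    using assms(4) that by (auto simp: weights_def PiE_def Pi_def)
  \<comment> \<open>The inclusion of \<open>F'\<close> in the edge set matters here: the restricted
    function is 0 on edges but \<open>undefined\<close> elsewhere.\<close>
  have zero: "(\<Sum>e\<in>F'. (\<lambda>e\<in>edges G. 0::real) e * indicator {e} f) = 0" for f
    using assms(3) by (intro sum.neutral) auto
  have single: "(\<Sum>e\<in>F. w e * indicator {e} f) = (if f \<in> F then w f else 0)" for f
    using finF by (simp add: indicator_def if_distrib sum.delta cong: if_cong)
  have "weighted_dist G (F, w) (F', \<lambda>e\<in>edges G. 0) = (\<Sum>f\<in>edges G. if f \<in> F then w f else 0)"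
    unfolding weighted_dist_def l1_norm_def case_prod_conv zero single
    \<comment> \<open>Each coordinate is 0 or a nonnegative weight, so the absolute values
      drop.\<close>
    by (intro sum.cong) (auto simp: w)
  also have "\<dots> = (\<Sum>f\<in>F. w f)"
    using assms(1,2) by (simp add: sum.inter_restrict [symmetric] Int_absorb1)
  finally show ?thesis .
qed

text \<open>The transport cost depends on the first marginal alone, so all couplings cost the same
  and the infimum involves no optimization.\<close>

lemma weighted_EM_zero:
  assumes "finite (edges G)" "set_pmf p \<subseteq> Pow (edges G)" "set_pmf q \<subseteq> Pow (edges G)"
    and "w \<in> weights G"
  shows "weighted_EM G (p, w) (q, \<lambda>e\<in>edges G. 0) = measure_pmf.expectation p (\<lambda>M. \<Sum>e\<in>M. w e)"
proof -
  have cost: "measure_pmf.expectation D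
        (\<lambda>(F, F'). weighted_dist G (F, w) (F', \<lambda>e\<in>edges G. 0))
      = measure_pmf.expectation p (\<lambda>M. \<Sum>e\<in>M. w e)" if "D \<in> couplings p q" for D
  proof -
    have D: "p = map_pmf fst D" "q = map_pmf snd D"
      using that by (auto simp: couplings_def)
    have "measure_pmf.expectation D (\<lambda>(F, F'). weighted_dist G (F, w) (F', \<lambda>e\<in>edges G. 0))
        = measure_pmf.expectation D (\<lambda>x. \<Sum>e\<in>fst x. w e)"
    \<comment> \<open>The integrands are compared only on the support of \<open>D\<close>, where
      both components are sets of edges because the marginals are \<open>p\<close> and
      \<open>q\<close>.\<close>
    proof (intro integral_cong_AE AE_pmfI)
      fix x assume "x \<in> set_pmf D"
      then have "fst x \<subseteq> edges G" "snd x \<subseteq> edges G"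
        using assms(2,3) D by auto
      then show "(case x of (F, F') \<Rightarrow> weighted_dist G (F, w) (F', \<lambda>e\<in>edges G. 0))
          = (\<Sum>e\<in>fst x. w e)"
        using assms(1,4) by (simp add: case_prod_beta weighted_dist_zero)
    qed simp_all
    then show ?thesis
      by (simp add: D(1))
  qed
  \<comment> \<open>The independent coupling shows that the infimum of the constant cost ranges over
    a nonempty set, hence equals that constant.\<close>
  have "pair_pmf p q \<in> couplings p q"
    by (simp add: couplings_def map_fst_pair_pmf map_snd_pair_pmf)
  then have "couplings p q \<noteq> {}"
    by blast
  then show ?thesis
    by (simp add: weighted_EM_def cost)
qed

text \<open>The pair of \<open>w\<close> and the zero weight is one competitor in the supremum;
  \<open>w\<close> being nonzero makes it admissible.\<close>

lemma lipschitz_constant_ge_approximation_ratio: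
  assumes "is_multigraph G" "approximation_algorithm \<alpha> A"
    and "w \<in> weights G" "w \<noteq> (\<lambda>e\<in>edges G. 0)"
  shows "lipschitz_constant A G \<ge> ennreal (\<alpha> * max_matching_weight G w / l1_norm G w)"
proof -
  define z :: "'b \<Rightarrow> real" where "z = (\<lambda>e\<in>edges G. 0)"
  have z: "z \<in> weights G"
    by (auto simp: z_def weights_def)
  have fin: "finite (edges G)"
    using assms(1) by (simp add: is_multigraph_def)
  have sub: "set_pmf (A G u) \<subseteq> Pow (edges G)" if "u \<in> weights G" for u
    using assms(1,2) that
    by (fastforce simp: approximation_algorithm_def matching_algorithm_def matchings_def)
  have diff: "l1_norm G (\<lambda>e. w e - z e) = l1_norm G w"
    by (simp add: l1_norm_def z_def)
  have "\<alpha> * max_matching_weight G w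
      \<le> measure_pmf.expectation (A G w) (\<lambda>M. \<Sum>e\<in>M. w e)"
    using assms(1-3) by (simp add: approximation_algorithm_def)
  also have "\<dots> = weighted_EM G (A G w, w) (A G z, z)"
    unfolding z_def by (rule weighted_EM_zero [symmetric])
      (use fin sub assms(3) z in \<open>auto simp: z_def\<close>)
  finally have "\<alpha> * max_matching_weight G w / l1_norm G w
      \<le> weighted_EM G (A G w, w) (A G z, z) / l1_norm G (\<lambda>e. w e - z e)"
    unfolding diff by (intro divide_right_mono) (auto simp: l1_norm_def sum_nonneg)
  then have "ennreal (\<alpha> * max_matching_weight G w / l1_norm G w)
      \<le> ennreal (weighted_EM G (A G w, w) (A G z, z) / l1_norm G (\<lambda>e. w e - z e))"
    by (rule ennreal_leI)
  also have "\<dots> \<le> lipschitz_constant A G"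
    unfolding lipschitz_constant_def
    by (rule SUP_upper2 [of "(w, z)"]) (use assms(3,4) z in \<open>auto simp: z_def\<close>)
  finally show ?thesis .
qed

theorem theorem6p3:
  shows "\<exists>c::real. c > 0 \<and>
    (\<forall>(\<alpha>::real) (A :: (nat, nat) algorithm).
       0 < \<alpha> \<longrightarrow> \<alpha> \<le> 1 \<longrightarrow> approximation_algorithm \<alpha> A \<longrightarrow>
       (\<exists>G. is_multigraph G \<and> lipschitz_constant A G \<ge> ennreal (c * \<alpha>)))"
proof (intro exI [of _ 1] conjI allI impI)
  fix \<alpha> :: real and A :: "(nat, nat) algorithm"
  assume A: "approximation_algorithm \<alpha> A"
  \<comment> \<open>On a single edge the maximum matching weight equals the l1 norm of the weight,
    the largest ratio possible. This is why c = 1 can be taken.\<close>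
  define G :: "(nat, nat) multigraph"
    where "G = \<lparr>verts = {0, 1}, edges = {0}, ends = (\<lambda>e\<in>{0}. {0, 1})\<rparr>"
  define w :: "nat \<Rightarrow> real" where "w = (\<lambda>e\<in>{0}. 1)"
  have G: "is_multigraph G"
    by (auto simp: is_multigraph_def G_def)
  have w: "w \<in> weights G"
    by (auto simp: weights_def G_def w_def)
  \<comment> \<open>Evaluating at the only edge separates the two weight functions.\<close>
  have "w 0 \<noteq> (\<lambda>e\<in>edges G. 0) 0"
    by (simp add: w_def G_def)
  then have w_nonzero: "w \<noteq> (\<lambda>e\<in>edges G. 0)"
    by metis
  have "matchings G = {{}, {0}}"
    by (auto simp: matchings_def G_def disjoint_family_on_def)
  then have "max_matching_weight G w = 1"
    by (simp add: max_matching_weight_def w_def)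
  moreover have "l1_norm G w = 1"
    by (simp add: l1_norm_def G_def w_def)
  ultimately have "lipschitz_constant A G \<ge> ennreal (1 * \<alpha>)"
    using lipschitz_constant_ge_approximation_ratio [OF G A w w_nonzero] by simp
  with G show "\<exists>G. is_multigraph G \<and> lipschitz_constant A G \<ge> ennreal (1 * \<alpha>)"
    by blast
qed simp

end
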